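(* Let $M$ and $N$ be two quasianalytic weight sequences and assume $\sup_{k\in\mathbb N_{>0}}n_k^{1/k}=+\infty$ (Roumieu case) resp. $\lim_{k\to+\infty}n_k^{1/k}=+\infty$ (Beurling case). Then $\Lambda^r_{[N]}\setminus j^\infty(\mathcal E^{0,r}_{\{M\}})$ is lineable in $\Lambda^r_{[N]}$ (and hence so is $\Lambda^r_{[N]}\setminus j^\infty(\mathcal E^{0,r}_{(M)})$).
   Context: For a sequence $M=(M_p)_{p\in\mathbb N}$ of positive reals write $m_p:=M_p/p!$ (and $n_p:=N_p/p!$). $M$ is a weight sequence if $1=M_0\le M_1$, $M_p^2\le M_{p-1}M_{p+1}$ for all $p\ge1$, and $\liminf_{p\to\infty}m_p^{1/p}>0$; it is quasianalytic if $\sum_{p\ge1}M_{p-1}/M_p=+\infty$. For $U\subseteq\mathbb R^r$ open, $K\subseteq U$ compact, $h>0$: $\|f\|^M_{K,h}:=\sup_{\alpha\in\mathbb N^r,x\in K}|\partial^\alpha f(x)|/(h^{|\alpha|}M_{|\alpha|})$. $\mathcal E_{\{M\}}(U)$ consists of smooth $f$ such that for every compact $K\subseteq U$ there exists $h>0$ with $\|f\|^M_{K,h}<\infty$; $\mathcal E_{(M)}(U)$: for every compact $K$ and every $h>0$. $\mathcal E^{0,r}_{\{M\}}$, $\mathcal E^{0,r}_{(M)}$ are the spaces of germs at $0\in\mathbb R^r$ of functions in the respective class on some cube $(-1/k,1/k)^r$. For $\mathbf b=(b_\alpha)_{\alpha\in\mathbb N^r}$ and $h>0$: $|\mathbf b|^N_h:=\sup_\alpha|b_\alpha|/(h^{|\alpha|}n_{|\alpha|})$;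 $\Lambda^r_{\{N\}}:=\{\mathbf b:\exists h>0,|\mathbf b|^N_h<\infty\}$, $\Lambda^r_{(N)}:=\{\mathbf b:\forall h>0,|\mathbf b|^N_h<\infty\}$. The Borel map is $j^\infty(f)=(\partial^\alpha f(0)/|\alpha|!)_{\alpha\in\mathbb N^r}$. The notation $[\cdot]$ means either $\{\cdot\}$ throughout (Roumieu) or $(\cdot)$ throughout (Beurling). A subset $L$ of a vector space $X$ is lineable if $L\cup\{0\}$ contains an infinite-dimensional vector subspace. *)

theory Defs
  imports "HOL-Analysis.Analysis" "HOL-Library.Liminf_Limsup"
begin

definition weight_seq :: "(nat \<Rightarrow> real) \<Rightarrow> bool" where
  "weight_seq M \<longleftrightarrow>
     (\<forall>p. M p > 0) \<and> M 0 = 1 \<and> M 0 \<le> M 1 \<and>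
     (\<forall>p\<ge>1. (M p)\<^sup>2 \<le> M (p - 1) * M (p + 1)) \<and>
     liminf (\<lambda>p. ereal (root p (M p / fact p))) > 0"

definition quasianalytic :: "(nat \<Rightarrow> real) \<Rightarrow> bool" where
  "quasianalytic M \<longleftrightarrow>
     filterlim (\<lambda>n. \<Sum>p=1..n. M (p - 1) / M p) at_top sequentially"

definition partial :: "'n::finite \<Rightarrow> (real^'n \<Rightarrow> real) \<Rightarrow> real^'n \<Rightarrow> real" where
  "partial i f x = deriv (\<lambda>t. f (x + t *\<^sub>R axis i 1)) 0"

fun partials :: "'n::finite list \<Rightarrow> (real^'n \<Rightarrow> real) \<Rightarrow> real^'n \<Rightarrow> real" where
  "partials [] f = f"
| "partials (i # is) f = partial i (partials is f)"

definition smooth_on :: "(real^'n::finite) set \<Rightarrow> (real^'n \<Rightarrow> real) \<Rightarrow> bool" where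
  "smooth_on U f \<longleftrightarrow>
     (\<forall>is. continuous_on U (partials is f) \<and>
        (\<forall>i. \<forall>x\<in>U. (\<lambda>t. partials is f (x + t *\<^sub>R axis i 1)) differentiable (at 0)))"

definition mlen :: "('n::finite \<Rightarrow> nat) \<Rightarrow> nat" where
  "mlen \<alpha> = (\<Sum>i\<in>UNIV. \<alpha> i)"

text \<open>The partial derivative of order alpha (for smooth f the order of differentiation is irrelevant).\<close>
definition dpartial :: "('n::finite \<Rightarrow> nat) \<Rightarrow> (real^'n \<Rightarrow> real) \<Rightarrow> real^'n \<Rightarrow> real" where
  "dpartial \<alpha> f = partials (SOME is. \<forall>i. length (filter ((=) i) is) = \<alpha> i) f"

definition dc_seminorm_bounded ::
  "(nat \<Rightarrow> real) \<Rightarrow> (real^'n::finite) set \<Rightarrow> real \<Rightarrow> (real^'n \<Rightarrow> real) \<Rightarrow> bool" where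
  "dc_seminorm_bounded M K h f \<longleftrightarrow>
     bdd_above {\<bar>dpartial \<alpha> f x\<bar> / (h ^ mlen \<alpha> * M (mlen \<alpha>)) | \<alpha> x. x \<in> K}"

definition E_Roumieu :: "(nat \<Rightarrow> real) \<Rightarrow> (real^'n::finite) set \<Rightarrow> (real^'n \<Rightarrow> real) set" where
  "E_Roumieu M U = {f. smooth_on U f \<and>
     (\<forall>K. compact K \<and> K \<subseteq> U \<longrightarrow> (\<exists>h>0. dc_seminorm_bounded M K h f))}"

definition E_Beurling :: "(nat \<Rightarrow> real) \<Rightarrow> (real^'n::finite) set \<Rightarrow> (real^'n \<Rightarrow> real) set" where
  "E_Beurling M U = {f. smooth_on U f \<and>
     (\<forall>K. compact K \<and> K \<subseteq> U \<longrightarrow> (\<forall>h>0. dc_seminorm_bounded M K h f))}"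

definition cube :: "nat \<Rightarrow> (real^'n::finite) set" where
  "cube k = {x. \<forall>i. \<bar>x $ i\<bar> < 1 / real k}"

text \<open>Borel map on a representative of a germ.\<close>
definition jet :: "(real^'n::finite \<Rightarrow> real) \<Rightarrow> ('n \<Rightarrow> nat) \<Rightarrow> real" where
  "jet f = (\<lambda>\<alpha>. dpartial \<alpha> f 0 / fact (mlen \<alpha>))"

text \<open>Images under the Borel map of the germ spaces at 0.\<close>
definition jets_Roumieu :: "(nat \<Rightarrow> real) \<Rightarrow> (('n::finite \<Rightarrow> nat) \<Rightarrow> real) set" where
  "jets_Roumieu M = {jet f | f k. k > 0 \<and> f \<in> E_Roumieu M (cube k)}"

definition jets_Beurling :: "(nat \<Rightarrow> real) \<Rightarrow> (('n::finite \<Rightarrow> nat) \<Rightarrow> real) set" where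
  "jets_Beurling M = {jet f | f k. k > 0 \<and> f \<in> E_Beurling M (cube k)}"

definition seq_bounded :: "(nat \<Rightarrow> real) \<Rightarrow> real \<Rightarrow> (('n::finite \<Rightarrow> nat) \<Rightarrow> real) \<Rightarrow> bool" where
  "seq_bounded N h b \<longleftrightarrow>
     bdd_above {\<bar>b \<alpha>\<bar> / (h ^ mlen \<alpha> * (N (mlen \<alpha>) / fact (mlen \<alpha>))) | \<alpha>. True}"

definition Lambda_Roumieu :: "(nat \<Rightarrow> real) \<Rightarrow> (('n::finite \<Rightarrow> nat) \<Rightarrow> real) set" where
  "Lambda_Roumieu N = {b. \<exists>h>0. seq_bounded N h b}"

definition Lambda_Beurling :: "(nat \<Rightarrow> real) \<Rightarrow> (('n::finite \<Rightarrow> nat) \<Rightarrow> real) set" where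
  "Lambda_Beurling N = {b. \<forall>h>0. seq_bounded N h b}"

definition is_subspace :: "('a \<Rightarrow> real) set \<Rightarrow> bool" where
  "is_subspace V \<longleftrightarrow> (\<lambda>_. 0) \<in> V \<and>
     (\<forall>u\<in>V. \<forall>v\<in>V. (\<lambda>a. u a + v a) \<in> V) \<and>
     (\<forall>c. \<forall>u\<in>V. (\<lambda>a. c * u a) \<in> V)"

definition lin_indep :: "('a \<Rightarrow> real) set \<Rightarrow> bool" where
  "lin_indep S \<longleftrightarrow> (\<forall>F c. finite F \<and> F \<subseteq> S \<and> (\<lambda>a. \<Sum>u\<in>F. c u * u a) = (\<lambda>_. 0)
       \<longrightarrow> (\<forall>u\<in>F. c u = 0))"

definition infinite_dim :: "('a \<Rightarrow> real) set \<Rightarrow> bool" where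
  "infinite_dim V \<longleftrightarrow> (\<exists>S. S \<subseteq> V \<and> infinite S \<and> lin_indep S)"

definition lineable :: "('a \<Rightarrow> real) set \<Rightarrow> bool" where
  "lineable L \<longleftrightarrow> (\<exists>V. is_subspace V \<and> infinite_dim V \<and> V \<subseteq> L \<union> {\<lambda>_. 0})"

end

theory Submission
  imports Defs
begin

text \<open>Along a coordinate axis, a quasianalytic function whose derivatives at \<open>0\<close> are all positive has
  positive derivatives on an interval \<open>[0, a]\<close>: otherwise Rolle's theorem gives zeros
  \<open>x\<^sub>0 > x\<^sub>1 > \<dots> > 0\<close> of the successive derivatives \<open>f\<^sup>(\<^sup>n\<^sup>)\<close>. Following the Bang degree
  \<open>B\<^sub>n(x) = sup\<^sub>j\<^sub>\<ge>\<^sub>n |f\<^sup>(\<^sup>j\<^sup>)(x)| / (e\<^sup>j M\<^sub>j)\<close> along \<open>0, x\<^sub>0, x\<^sub>1, \<dots>\<close>, a path of length at most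
  \<open>2 x\<^sub>0\<close>, its value has to fall from a positive number to \<open>0\<close>, while passing from \<open>e\<^sup>-\<^sup>k\<^sup>+\<^sup>1\<close> to \<open>e\<^sup>-\<^sup>k\<close>
  costs at least the length \<open>M\<^sub>k\<^sub>-\<^sub>1 / (e M\<^sub>k)\<close>; these lengths have a divergent sum. By Taylor's
  formula the positivity of all derivatives bounds the Taylor coefficients geometrically
  (Bernstein). Hence no jet with eventually positive (or eventually negative) axis coefficients and
  vanishing radius of convergence is attained. All nonzero sequences \<open>p(|\<alpha>|) s\<^bsub>|\<alpha>|\<^esub>\<close>, with \<open>p\<close> a
  real polynomial and \<open>s\<^sub>k = n\<^sub>k\<close> (Roumieu) or \<open>s\<^sub>k = \<surd>n\<^sub>k\<close> (Beurling), are of this kind.\<close>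

section \<open>Growth of the Bang degree for derivatives of a function of one variable\<close>

lemma exp_ge_partial_sum:
  fixes x :: real
  assumes "0 \<le> x"
  shows "(\<Sum>m<n. x ^ m / fact m) \<le> exp x"
proof -
  have "(\<Sum>m<n. inverse (fact m) * x ^ m) \<le> (\<Sum>m. inverse (fact m) * x ^ m)"
    by (rule sum_le_suminf) (use summable_exp[of x] assms in auto)
  thus ?thesis
    by (simp add: exp_def divide_inverse scaleR_conv_of_real mult.commute)
qed

text \<open>\<open>g\<close> lists the successive derivatives of one function on
  \<open>{0..a}\<close>. Constants of the form \<open>C * h ^ j\<close> are absorbed into
  \<open>M\<close>, so the majorant stays log-convex and the setting is stable under passing to a
  higher derivative.\<close>

locale log_convex_jet =
  fixes M :: "nat \<Rightarrow> real" and g :: "nat \<Rightarrow> real \<Rightarrow> real" and a :: real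
  assumes M_pos: "M j > 0"
    and log_convex: "(M (Suc j))\<^sup>2 \<le> M j * M (Suc (Suc j))"
    and has_deriv: "\<lbrakk>0 \<le> t; t \<le> a\<rbrakk> \<Longrightarrow> (g j has_real_derivative g (Suc j) t) (at t)"
    and bound: "\<lbrakk>0 \<le> t; t \<le> a\<rbrakk> \<Longrightarrow> \<bar>g j t\<bar> \<le> M j"
begin

text \<open>Truncated subtraction gives \<open>ratio 0 = 1\<close>: positivity holds at every index,
  but monotonicity only from index 1 on.\<close>

definition ratio :: "nat \<Rightarrow> real" where
  "ratio k = M k / M (k - 1)"

definition bang_degree :: "nat \<Rightarrow> real \<Rightarrow> real" where
  "bang_degree n x = (SUP j\<in>{n..}. \<bar>g j x\<bar> / (exp (real j) * M j))"

lemma ratio_pos: "ratio k > 0"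
  using M_pos by (simp add: ratio_def)

lemma ratio_mono:
  assumes "1 \<le> k" "k \<le> l"
  shows "ratio k \<le> ratio l"
  using assms(2)
proof (induction l rule: dec_induct)
  case (step l)
  obtain i where l: "l = Suc i" using step assms by (cases l) auto
  have "ratio l \<le> ratio (Suc l)"
    using log_convex[of i] M_pos[of i] M_pos[of "Suc i"]
    by (simp add: ratio_def l field_simps power2_eq_square)
  with step show ?case by simp
qed simp

text \<open>\<open>M (j + m)\<close> is \<open>M j\<close> times the ratios of indices
  \<open>j + 1\<close> to \<open>j + m\<close>, and none of these exceeds
  \<open>ratio k\<close>.\<close>

lemma M_add_le:
  assumes "j + m \<le> k"
  shows "M (j + m) \<le> M j * ratio k ^ m"
  using assms
proof (induction m)
  case (Suc m)
  have "M (j + Suc m) = M (j + m) * ratio (Suc (j + m))"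
    using M_pos[of "j + m"] by (simp add: ratio_def)
  also have "\<dots> \<le> (M j * ratio k ^ m) * ratio k"
    using Suc M_pos ratio_pos ratio_mono
    by (intro mult_mono) (auto simp: less_imp_le)
  finally show ?case by (simp add: mult_ac)
qed simp

lemma term_le:
  assumes "0 \<le> x" "x \<le> a"
  shows "\<bar>g j x\<bar> / (exp (real j) * M j) \<le> exp (- real j)"
proof -
  have "\<bar>g j x\<bar> / (exp (real j) * M j) \<le> M j / (exp (real j) * M j)"
    using bound[OF assms] M_pos[of j] by (intro divide_right_mono) auto
  also have "\<dots> = exp (- real j)"
    using M_pos[of j] by (simp add: exp_minus field_simps)
  finally show ?thesis .
qed

lemma bdd_above_terms:
  assumes "0 \<le> x" "x \<le> a"
  shows "bdd_above ((\<lambda>j. \<bar>g j x\<bar> / (exp (real j) * M j)) ` {n..})"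
  by (rule bdd_aboveI2[of _ _ 1], rule order_trans[OF term_le[OF assms]]) simp

lemma term_le_bang_degree:
  assumes "0 \<le> x" "x \<le> a" "n \<le> j"
  shows "\<bar>g j x\<bar> / (exp (real j) * M j) \<le> bang_degree n x"
  unfolding bang_degree_def
  by (rule cSUP_upper) (use assms bdd_above_terms in auto)

lemma bang_degree_leI:
  assumes "\<And>j. n \<le> j \<Longrightarrow> \<bar>g j x\<bar> / (exp (real j) * M j) \<le> c"
  shows "bang_degree n x \<le> c"
  unfolding bang_degree_def by (rule cSUP_least) (use assms in auto)

lemma bang_degree_le:
  assumes "0 \<le> x" "x \<le> a"
  shows "bang_degree n x \<le> exp (- real n)"
  by (rule bang_degree_leI, rule order_trans[OF term_le[OF assms]]) simp

text \<open>At a zero of \<open>g n\<close> the first term of the supremum is 0 and the remaining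
  ones are nonnegative. The index can therefore be raised at a zero without any loss.\<close>

lemma bang_degree_Suc:
  assumes "0 \<le> x" "x \<le> a" "g n x = 0"
  shows "bang_degree n x = bang_degree (Suc n) x"
proof (rule antisym)
  have "0 \<le> \<bar>g (Suc n) x\<bar> / (exp (real (Suc n)) * M (Suc n))"
    using M_pos[of "Suc n"] by simp
  also have "\<dots> \<le> bang_degree (Suc n) x"
    using assms by (intro term_le_bang_degree) auto
  finally have nn: "0 \<le> bang_degree (Suc n) x" .
  show "bang_degree n x \<le> bang_degree (Suc n) x"
  proof (rule bang_degree_leI)
    fix j assume "n \<le> j"
    show "\<bar>g j x\<bar> / (exp (real j) * M j) \<le> bang_degree (Suc n) x"
    proof (cases "j = n")
      case True thus ?thesis using nn assms by simp
    next
      case False thus ?thesis using \<open>n \<le> j\<close> assms by (intro term_le_bang_degree) auto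
    qed
  qed
  show "bang_degree (Suc n) x \<le> bang_degree n x"
    using assms by (intro bang_degree_leI term_le_bang_degree) auto
qed

text \<open>Terms with \<open>j \<ge> k\<close> are at most \<open>exp (- real k)\<close> anyway.
  For \<open>j < k\<close>, expand \<open>g j\<close> at \<open>x\<close> up to order
  \<open>k\<close>: by \<open>M_add_le\<close> the summands are dominated by those of the
  exponential series of \<open>exp 1 * ratio k * \<bar>y - x\<bar>\<close>.\<close>

lemma bang_degree_growth:
  assumes x: "0 \<le> x" "x \<le> a" and y: "0 \<le> y" "y \<le> a"
  shows "max (bang_degree n y) (exp (- real k))
       \<le> max (bang_degree n x) (exp (- real k)) * exp (exp 1 * ratio k * \<bar>y - x\<bar>)"
    (is "_ \<le> ?B * exp ?w")
proof -
  have w: "0 \<le> ?w" using ratio_pos[of k] by simp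
  have B: "0 < ?B" by (simp add: less_max_iff_disj)
  have "?B * 1 \<le> ?B * exp ?w"
    using B w by (intro mult_left_mono) auto
  hence Bw: "?B \<le> ?B * exp ?w" by (simp only: mult_1_right)
  have "\<bar>g j y\<bar> / (exp (real j) * M j) \<le> ?B * exp ?w" if j: "n \<le> j" for j
  proof -
    \<comment> \<open>The case \<open>x = y\<close> is separate because Taylor's theorem asks for
      distinct points.\<close>
    consider "k \<le> j" | "x = y" | "j < k" "x \<noteq> y" by linarith
    thus ?thesis
    proof cases
      case 1
      have "\<bar>g j y\<bar> / (exp (real j) * M j) \<le> exp (- real j)" by (rule term_le[OF y])
      also have "\<dots> \<le> ?B" using 1 by (simp add: le_max_iff_disj)
      finally show ?thesis using Bw by linarith
    next
      case 2
      have "\<bar>g j y\<bar> / (exp (real j) * M j) \<le> ?B"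
        using term_le_bang_degree[OF x j] 2 by simp
      thus ?thesis using Bw by linarith
    next
      case 3
      define N where "N = k - j"
      have N: "0 < N" "j + N = k" using 3 by (auto simp: N_def)
      have "\<exists>t. (if y < x then y < t \<and> t < x else x < t \<and> t < y) \<and>
          g j y = (\<Sum>m<N. g (j + m) x / fact m * (y - x) ^ m) + g (j + N) t / fact N * (y - x) ^ N"
        by (rule Taylor[where a = 0 and b = a and diff = "\<lambda>m. g (j + m)"])
           (use N 3 x y has_deriv in auto)
      then obtain t where t: "if y < x then y < t \<and> t < x else x < t \<and> t < y" and
        eq: "g j y = (\<Sum>m<N. g (j + m) x / fact m * (y - x) ^ m) + g k t / fact N * (y - x) ^ N"
        using N by blast
      have t: "0 \<le> t" "t \<le> a" using t x y by (auto split: if_splits)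
      \<comment> \<open>One estimate for both the Taylor coefficients at \<open>x\<close> and the
        remainder: the factor \<open>exp (real m)\<close> from the weights and
        \<open>ratio k ^ m\<close> combine with \<open>\<bar>y - x\<bar> ^ m\<close> to
        \<open>?w ^ m\<close>.\<close>
      have key: "\<bar>c / fact m * (y - x) ^ m\<bar> \<le> ?B * (exp (real j) * M j) * (?w ^ m / fact m)"
        if "\<bar>c\<bar> \<le> ?B * (exp (real (j + m)) * M (j + m))" "m \<le> N" for c m
      proof -
        have "\<bar>c / fact m * (y - x) ^ m\<bar> = \<bar>c\<bar> * (\<bar>y - x\<bar> ^ m / fact m)"
          by (simp add: abs_mult power_abs)
        also have "\<dots> \<le> (?B * (exp (real (j + m)) * (M j * ratio k ^ m))) * (\<bar>y - x\<bar> ^ m / fact m)"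
        proof (rule mult_right_mono)
          have "?B * (exp (real (j + m)) * M (j + m)) \<le> ?B * (exp (real (j + m)) * (M j * ratio k ^ m))"
            using B M_add_le[of j m k] that N by (intro mult_left_mono) auto
          with that show "\<bar>c\<bar> \<le> ?B * (exp (real (j + m)) * (M j * ratio k ^ m))" by linarith
        qed simp
        also have "\<dots> = ?B * (exp (real j) * M j) * (?w ^ m / fact m)"
          by (simp add: exp_add power_mult_distrib exp_of_nat_mult[of m 1, simplified] mult_ac)
        finally show ?thesis .
      qed
      have "\<bar>g j y\<bar> \<le> (\<Sum>m<N. \<bar>g (j + m) x / fact m * (y - x) ^ m\<bar>) + \<bar>g k t / fact N * (y - x) ^ N\<bar>"
        unfolding eq by (rule order_trans[OF abs_triangle_ineq add_right_mono]) (rule sum_abs)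
      also have "\<dots> \<le> (\<Sum>m<N. ?B * (exp (real j) * M j) * (?w ^ m / fact m))
                       + ?B * (exp (real j) * M j) * (?w ^ N / fact N)"
      proof (rule add_mono[OF sum_mono])
        fix m assume m: "m \<in> {..<N}"
        have "\<bar>g (j + m) x\<bar> / (exp (real (j + m)) * M (j + m)) \<le> ?B"
          using term_le_bang_degree[OF x, of n "j + m"] j by simp
        hence "\<bar>g (j + m) x\<bar> \<le> ?B * (exp (real (j + m)) * M (j + m))"
          using M_pos[of "j + m"] by (simp only: pos_divide_le_eq mult_pos_pos exp_gt_zero)
        thus "\<bar>g (j + m) x / fact m * (y - x) ^ m\<bar> \<le> ?B * (exp (real j) * M j) * (?w ^ m / fact m)"
          using m by (intro key) auto
      next
        \<comment> \<open>At the intermediate point \<open>t\<close> only the global bound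
          \<open>M k\<close> is available; it is the reason for the maximum with
          \<open>exp (- real k)\<close>.\<close>
        have "\<bar>g k t\<bar> \<le> exp (- real k) * (exp (real k) * M k)"
          using bound[OF t, of k] by (simp add: exp_minus field_simps)
        also have "\<dots> \<le> ?B * (exp (real k) * M k)"
          using M_pos[of k] by (intro mult_right_mono) (auto simp: le_max_iff_disj)
        finally have "\<bar>g k t\<bar> \<le> ?B * (exp (real k) * M k)" .
        thus "\<bar>g k t / fact N * (y - x) ^ N\<bar> \<le> ?B * (exp (real j) * M j) * (?w ^ N / fact N)"
          using N by (intro key) auto
      qed
      also have "\<dots> = ?B * (exp (real j) * M j) * (\<Sum>m<Suc N. ?w ^ m / fact m)"
        by (simp add: sum_distrib_left distrib_left)
      also have "\<dots> \<le> ?B * (exp (real j) * M j) * exp ?w"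
        using B M_pos[of j] by (intro mult_left_mono exp_ge_partial_sum w) auto
      finally have "\<bar>g j y\<bar> \<le> (?B * exp ?w) * (exp (real j) * M j)" by (simp add: mult_ac)
      thus ?thesis
        using M_pos[of j] by (simp only: pos_divide_le_eq mult_pos_pos exp_gt_zero)
    qed
  qed
  hence "bang_degree n y \<le> ?B * exp ?w" by (rule bang_degree_leI)
  moreover have "exp (- real k) \<le> ?B * exp ?w"
    using Bw max.cobounded2 order_trans by blast
  ultimately show ?thesis by (rule max.boundedI)
qed

section \<open>The logarithmic degree and a potential that is 1-Lipschitz along it\<close>

definition log_degree :: "nat \<Rightarrow> nat \<Rightarrow> real \<Rightarrow> real" where
  "log_degree K n x = ln (max (bang_degree n x) (exp (- real K)))"

text \<open>The truncation at \<open>exp (- real K)\<close> keeps the argument of the logarithm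
  positive and leaves only finitely many unit levels below 0 to cross.\<close>

lemma log_degree_ge: "- real K \<le> log_degree K n x"
  unfolding log_degree_def by (rule ln_ge_iff[THEN iffD2]) (auto simp: less_max_iff_disj)

lemma log_degree_le_0:
  assumes "0 \<le> x" "x \<le> a"
  shows "log_degree K n x \<le> 0"
proof -
  have "exp (- real n) \<le> 1" by simp
  hence "bang_degree n x \<le> 1" using bang_degree_le[OF assms, of n] by linarith
  thus ?thesis unfolding log_degree_def by (subst ln_le_zero_iff) (auto simp: less_max_iff_disj)
qed

lemma max_log_degree:
  assumes "k \<le> K"
  shows "max (log_degree K n x) (- real k) = ln (max (bang_degree n x) (exp (- real k)))"
proof -
  have mono: "max (ln u) (ln v) = ln (max u v)" if "0 < u" "0 < v" for u v :: real
    using that by (auto simp: max_def)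
  have le: "exp (- real K) \<le> exp (- real k)" using assms by simp
  have "max (log_degree K n x) (- real k)
      = max (ln (max (bang_degree n x) (exp (- real K)))) (ln (exp (- real k)))"
    by (simp add: log_degree_def)
  also have "\<dots> = ln (max (max (bang_degree n x) (exp (- real K))) (exp (- real k)))"
    by (rule mono) (auto simp: less_max_iff_disj)
  also have "max (max (bang_degree n x) (exp (- real K))) (exp (- real k))
      = max (bang_degree n x) (exp (- real k))"
    using le by linarith
  finally show ?thesis .
qed

text \<open>Logarithm of \<open>bang_degree_growth\<close>: as long as it stays above
  \<open>- real k\<close>, the logarithmic degree changes at rate at most
  \<open>exp 1 * ratio k\<close>.\<close>

lemma log_degree_growth:
  assumes "0 \<le> x" "x \<le> a" "0 \<le> y" "y \<le> a" "k \<le> K"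
  shows "max (log_degree K n y) (- real k)
       \<le> max (log_degree K n x) (- real k) + exp 1 * ratio k * \<bar>y - x\<bar>"
proof -
  have pos: "0 < max (bang_degree n z) (exp (- real k))" for z
    by (simp add: less_max_iff_disj)
  have "ln (max (bang_degree n y) (exp (- real k)))
      \<le> ln (max (bang_degree n x) (exp (- real k)) * exp (exp 1 * ratio k * \<bar>y - x\<bar>))"
    using bang_degree_growth[OF assms(1-4), of n k] pos by (subst ln_le_cancel_iff) auto
  also have "\<dots> = ln (max (bang_degree n x) (exp (- real k))) + exp 1 * ratio k * \<bar>y - x\<bar>"
    using pos by (subst ln_mult_pos) auto
  finally show ?thesis by (simp only: max_log_degree[OF assms(5)])
qed

text \<open>The potential is chosen so that its slope on \<open>[-k, -k+1]\<close> is the reciprocal of the rate at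
  which the logarithm of the Bang degree may change there.\<close>
definition potential :: "nat \<Rightarrow> real \<Rightarrow> real" where
  "potential K u = (\<Sum>k=1..K. min 1 (max 0 (u + real k)) / (exp 1 * ratio k))"

text \<open>On the level between \<open>- real k\<close> and \<open>1 - real k\<close> only the
  summand of index \<open>k\<close> varies: those of smaller index are still 0, those of larger
  index already saturated.\<close>

lemma potential_diff:
  assumes k: "1 \<le> k" "k \<le> K" and u: "- real k \<le> u" "u \<le> 1 - real k"
    and v: "- real k \<le> v" "v \<le> 1 - real k"
  shows "potential K v - potential K u = (v - u) / (exp 1 * ratio k)"
proof -
  have "potential K v - potential K u
      = (\<Sum>l=1..K. (min 1 (max 0 (v + real l)) - min 1 (max 0 (u + real l))) / (exp 1 * ratio l))"
    by (simp add: potential_def sum_subtractf diff_divide_distrib)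
  also have "\<dots> = (\<Sum>l=1..K. if l = k then (v - u) / (exp 1 * ratio k) else 0)"
  proof (rule sum.cong)
    fix l
    consider "l = k" | "real l + 1 \<le> real k" | "real k + 1 \<le> real l" by linarith
    thus "(min 1 (max 0 (v + real l)) - min 1 (max 0 (u + real l))) / (exp 1 * ratio l)
        = (if l = k then (v - u) / (exp 1 * ratio k) else 0)"
    proof cases
      case 1
      thus ?thesis using u v by (simp add: min_def max_def)
    next
      case 2
      hence "max 0 (v + real l) = 0" "max 0 (u + real l) = 0" "l \<noteq> k" using u v by auto
      thus ?thesis by simp
    next
      case 3
      hence "min 1 (max 0 (v + real l)) = 1" "min 1 (max 0 (u + real l)) = 1" "l \<noteq> k"
        using u v by auto
      thus ?thesis by simp
    qed
  qed simp
  also have "\<dots> = (v - u) / (exp 1 * ratio k)" using k by simp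
  finally show ?thesis .
qed

text \<open>The rate depends on the level, so the estimate is local, and at an integer value the
  level to use differs for increase and decrease. For an increase, \<open>k\<close> is chosen with
  \<open>log_degree K n x\<close> in the level but strictly below its upper end.\<close>

lemma potential_local_up:
  assumes x: "0 \<le> x" "x \<le> a"
  obtains d where "d > 0"
    "\<And>y. \<lbrakk>0 \<le> y; y \<le> a; \<bar>y - x\<bar> < d; log_degree K n x < log_degree K n y\<rbrakk>
      \<Longrightarrow> \<bar>potential K (log_degree K n y) - potential K (log_degree K n x)\<bar> \<le> \<bar>y - x\<bar>"
proof (cases "log_degree K n x < 0")
  case False
  hence "\<not> log_degree K n x < log_degree K n y" if "0 \<le> y" "y \<le> a" for y
    using log_degree_le_0[OF that, of K n] by linarith
  thus ?thesis using that[of 1] by auto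
next
  case True
  define u where "u = log_degree K n x"
  define k where "k = nat \<lceil>- u\<rceil>"
  have k: "1 \<le> k" "k \<le> K" "- real k \<le> u" "u < 1 - real k"
    using True log_degree_ge[of K n x] unfolding u_def[symmetric] k_def by linarith+
  let ?w = "exp 1 * ratio k"
  have w: "0 < ?w" using ratio_pos by simp
  show ?thesis
  \<comment> \<open>The distance needed to reach the upper end of the level at the maximal rate;
    closer points stay in the level.\<close>
  proof (rule that[of "(1 - real k - u) / ?w"])
    show "(1 - real k - u) / ?w > 0" using k w by simp
    fix y assume y: "0 \<le> y" "y \<le> a" "\<bar>y - x\<bar> < (1 - real k - u) / ?w" and
      up: "log_degree K n x < log_degree K n y"
    define v where "v = log_degree K n y"
    have uv: "u < v" using up by (simp add: u_def v_def)
    have "max v (- real k) \<le> max u (- real k) + ?w * \<bar>y - x\<bar>"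
      unfolding u_def v_def by (rule log_degree_growth[OF x y(1,2) k(2)])
    hence *: "v - u \<le> ?w * \<bar>y - x\<bar>" using k by simp
    moreover have "?w * \<bar>y - x\<bar> < 1 - real k - u"
      using y(3) w by (simp add: pos_less_divide_eq mult.commute)
    ultimately have "potential K v - potential K u = (v - u) / ?w"
      using k uv by (intro potential_diff) auto
    moreover have "(v - u) / ?w \<le> \<bar>y - x\<bar>" using * w by (simp add: pos_divide_le_eq mult.commute)
    moreover have "0 \<le> (v - u) / ?w" using uv w by simp
    ultimately show "\<bar>potential K (log_degree K n y) - potential K (log_degree K n x)\<bar> \<le> \<bar>y - x\<bar>"
      by (simp add: u_def v_def)
  qed
qed

text \<open>Mirror image: the level now contains \<open>log_degree K n x\<close> strictly above its
  lower end, and the growth estimate is used from \<open>y\<close> to \<open>x\<close>.\<close>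

lemma potential_local_down:
  assumes x: "0 \<le> x" "x \<le> a"
  obtains d where "d > 0"
    "\<And>y. \<lbrakk>0 \<le> y; y \<le> a; \<bar>y - x\<bar> < d; log_degree K n y < log_degree K n x\<rbrakk>
      \<Longrightarrow> \<bar>potential K (log_degree K n y) - potential K (log_degree K n x)\<bar> \<le> \<bar>y - x\<bar>"
proof (cases "log_degree K n x > - real K")
  case False
  hence "\<not> log_degree K n y < log_degree K n x" for y
    using log_degree_ge[of K n y] by linarith
  thus ?thesis using that[of 1] by auto
next
  case True
  define u where "u = log_degree K n x"
  define k where "k = Suc (nat \<lfloor>- u\<rfloor>)"
  have k: "1 \<le> k" "k \<le> K" "- real k < u" "u \<le> 1 - real k"
    using True log_degree_le_0[OF x, of K n] unfolding u_def[symmetric] k_def by linarith+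
  let ?w = "exp 1 * ratio k"
  have w: "0 < ?w" using ratio_pos by simp
  show ?thesis
  proof (rule that[of "(u + real k) / ?w"])
    show "(u + real k) / ?w > 0" using k w by simp
    fix y assume y: "0 \<le> y" "y \<le> a" "\<bar>y - x\<bar> < (u + real k) / ?w" and
      down: "log_degree K n y < log_degree K n x"
    define v where "v = log_degree K n y"
    have uv: "v < u" using down by (simp add: u_def v_def)
    have "max u (- real k) \<le> max v (- real k) + ?w * \<bar>x - y\<bar>"
      unfolding u_def v_def by (rule log_degree_growth[OF y(1,2) x k(2)])
    hence "u \<le> max v (- real k) + ?w * \<bar>y - x\<bar>" using k by (simp add: abs_minus_commute)
    moreover have "?w * \<bar>y - x\<bar> < u + real k"
      using y(3) w by (simp add: pos_less_divide_eq mult.commute)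
    \<comment> \<open>If \<open>v \<le> - real k\<close>, the two estimates would give
      \<open>u \<le> - real k + ?w * \<bar>y - x\<bar> < u\<close>.\<close>
    ultimately have *: "u - v \<le> ?w * \<bar>y - x\<bar>" and "- real k < v" by (auto simp: max_def split: if_splits)
    hence "potential K u - potential K v = (u - v) / ?w"
      using k uv by (intro potential_diff) auto
    moreover have "(u - v) / ?w \<le> \<bar>y - x\<bar>" using * w by (simp add: pos_divide_le_eq mult.commute)
    moreover have "0 \<le> (u - v) / ?w" using uv w by simp
    ultimately show "\<bar>potential K (log_degree K n y) - potential K (log_degree K n x)\<bar> \<le> \<bar>y - x\<bar>"
      by (simp add: u_def v_def)
  qed
qed

text \<open>The local estimates compare a centre with nearby points on either side; Bolzano's
  bisection principle glues them along the interval.\<close>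

lemma potential_lipschitz:
  assumes "0 \<le> x" "x \<le> y" "y \<le> a"
  shows "\<bar>potential K (log_degree K n y) - potential K (log_degree K n x)\<bar> \<le> y - x"
proof -
  let ?\<phi> = "\<lambda>x. potential K (log_degree K n x)"
  \<comment> \<open>The range condition is part of the predicate because the local step of the
    bisection also meets points outside the interval.\<close>
  have "0 \<le> x \<and> y \<le> a \<longrightarrow> \<bar>?\<phi> y - ?\<phi> x\<bar> \<le> y - x"
  proof (rule Bolzano[where P = "\<lambda>x y. 0 \<le> x \<and> y \<le> a \<longrightarrow> \<bar>?\<phi> y - ?\<phi> x\<bar> \<le> y - x"])
    fix p assume "x \<le> p" "p \<le> y"
    hence p: "0 \<le> p" "p \<le> a" using assms by auto
    obtain d where d: "d > 0" "\<And>y. \<lbrakk>0 \<le> y; y \<le> a; \<bar>y - p\<bar> < d; log_degree K n p < log_degree K n y\<rbrakk>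
      \<Longrightarrow> \<bar>?\<phi> y - ?\<phi> p\<bar> \<le> \<bar>y - p\<bar>" using potential_local_up[OF p, of K n] by blast
    obtain e where e: "e > 0" "\<And>y. \<lbrakk>0 \<le> y; y \<le> a; \<bar>y - p\<bar> < e; log_degree K n y < log_degree K n p\<rbrakk>
      \<Longrightarrow> \<bar>?\<phi> y - ?\<phi> p\<bar> \<le> \<bar>y - p\<bar>" using potential_local_down[OF p, of K n] by blast
    have loc: "\<bar>?\<phi> q - ?\<phi> p\<bar> \<le> \<bar>q - p\<bar>" if "0 \<le> q" "q \<le> a" "\<bar>q - p\<bar> < min d e" for q
      using d(2)[of q] e(2)[of q] that
      by (cases "log_degree K n p" "log_degree K n q" rule: linorder_cases) auto
    show "\<exists>d>0. \<forall>s t. s \<le> p \<and> p \<le> t \<and> t - s < d \<longrightarrow> (0 \<le> s \<and> t \<le> a \<longrightarrow> \<bar>?\<phi> t - ?\<phi> s\<bar> \<le> t - s)"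
    proof (intro exI[of _ "min d e"] conjI allI impI)
      show "0 < min d e" using d e by simp
      fix s t assume *: "s \<le> p \<and> p \<le> t \<and> t - s < min d e" "0 \<le> s \<and> t \<le> a"
      have "\<bar>?\<phi> t - ?\<phi> p\<bar> \<le> \<bar>t - p\<bar>" "\<bar>?\<phi> s - ?\<phi> p\<bar> \<le> \<bar>s - p\<bar>"
        by (rule loc; use * p in linarith)+
      thus "\<bar>?\<phi> t - ?\<phi> s\<bar> \<le> t - s" using * by linarith
    qed
  qed (use assms in auto)
  thus ?thesis using assms by simp
qed

text \<open>The path bounds the potential at 0 by \<open>2 * a\<close> for every \<open>K\<close>,
  whereas that potential contains arbitrarily long blocks of the series, up to the factor
  \<open>exp 1\<close>.\<close>

lemma bang_decreasing_zeros:
  assumes z: "\<And>n. 0 < z n" "\<And>n. z n \<le> a" "\<And>n. z (Suc n) \<le> z n" "\<And>n. g n (z n) = 0"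
    and g0: "g 0 0 \<noteq> 0"
  shows "summable (\<lambda>p. M p / M (Suc p))"
proof -
  have z': "0 \<le> z n" for n using z(1)[of n] by simp
  have a: "0 \<le> a" using z(2)[of 0] z'[of 0] by simp
  have start: "potential K (log_degree K 0 0) \<le> 2 * a" for K
  proof -
    \<comment> \<open>The way from 0 to \<open>z 0\<close> costs \<open>z 0\<close>, the way back to
      \<open>z n\<close> costs \<open>z 0 - z n\<close>; raising the index at each zero is
      free.\<close>
    have "potential K (log_degree K n (z n)) \<ge> potential K (log_degree K 0 0) - z 0 - (z 0 - z n)" for n
    proof (induction n)
      case 0
      show ?case using potential_lipschitz[of 0 "z 0" K 0] z' z by (simp add: abs_le_iff)
    next
      case (Suc n)
      have "log_degree K n (z n) = log_degree K (Suc n) (z n)"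
        using bang_degree_Suc z' z by (simp add: log_degree_def)
      thus ?case
        using Suc potential_lipschitz[of "z (Suc n)" "z n" K "Suc n"] z' z by (simp add: abs_le_iff)
    qed
    from this[of K] have "potential K (log_degree K 0 0) \<le> potential K (log_degree K K (z K)) + 2 * a"
      using z'[of K] z(2)[of 0] by linarith
    \<comment> \<open>With index \<open>K\<close> all terms are at most
      \<open>exp (- real K)\<close>, so after \<open>K\<close> zeros the potential is used
      up.\<close>
    moreover have "log_degree K K (z K) = - real K"
      using bang_degree_le[OF z' z(2), of K K] by (simp add: log_degree_def max_def)
    moreover have "potential K (- real K) = 0"
      unfolding potential_def by (intro sum.neutral) auto
    ultimately show ?thesis by simp
  qed
  define c where "c = \<bar>g 0 0\<bar> / M 0"
  have c: "c > 0" using g0 M_pos by (simp add: c_def)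
  have "c \<le> bang_degree 0 0"
    using term_le_bang_degree[of 0 0 0] a by (simp add: c_def)
  hence logc: "ln c \<le> log_degree K 0 0" for K
    unfolding log_degree_def using c by (subst ln_le_cancel_iff) auto
  \<comment> \<open>Since \<open>- real m \<le> ln c\<close>, all summands of the potential at 0
    from index \<open>m + 1\<close> on are saturated and equal \<open>1 / (exp 1 * ratio k)\<close>.
    Taking \<open>K = m + n\<close> makes \<open>n\<close> of them available.\<close>
  define m where "m = nat \<lceil>- ln c\<rceil>"
  have "(\<Sum>i<n. M (i + m) / M (Suc (i + m))) \<le> exp 1 * (2 * a)" for n
  proof -
    let ?t = "\<lambda>k. min 1 (max 0 (log_degree (m + n) 0 0 + real k)) / (exp 1 * ratio k)"
    have nn: "0 \<le> ?t k" for k using ratio_pos[of k] by simp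
    have "(\<Sum>i<n. M (i + m) / M (Suc (i + m)) / exp 1) = (\<Sum>i<n. ?t (Suc (i + m)))"
    proof (rule sum.cong)
      fix i
      have "- ln c \<le> real m" unfolding m_def by linarith
      hence "1 \<le> log_degree (m + n) 0 0 + real (Suc (i + m))"
        using logc[of "m + n"] by simp
      hence "min 1 (max 0 (log_degree (m + n) 0 0 + real (Suc (i + m)))) = 1" by linarith
      thus "M (i + m) / M (Suc (i + m)) / exp 1 = ?t (Suc (i + m))"
        by (simp add: ratio_def)
    qed simp
    also have "\<dots> = sum ?t ((\<lambda>i. Suc (i + m)) ` {..<n})"
      by (subst sum.reindex) (auto simp: inj_on_def)
    also have "\<dots> \<le> sum ?t {1..m + n}"
      using nn by (intro sum_mono2) auto
    also have "\<dots> = potential (m + n) (log_degree (m + n) 0 0)" by (simp add: potential_def)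
    also have "\<dots> \<le> 2 * a" by (rule start)
    finally have "(\<Sum>i<n. M (i + m) / M (Suc (i + m))) / exp 1 \<le> 2 * a"
      by (simp only: sum_divide_distrib)
    thus ?thesis by (simp add: pos_divide_le_eq mult.commute)
  qed
  hence "summable (\<lambda>i. M (i + m) / M (Suc (i + m)))"
    using M_pos by (intro summableI_nonneg_bounded) (auto simp: less_imp_le)
  thus ?thesis by (subst (asm) summable_iff_shift[of "\<lambda>i. M i / M (Suc i)" m])
qed

section \<open>Positive jets: positivity on the interval and Bernstein's coefficient
  estimate\<close>

lemma zero_between:
  assumes "0 \<le> t" "t \<le> a" "g n 0 > 0" "g n t \<le> 0"
  obtains y where "0 < y" "y \<le> t" "g n y = 0"
proof -
  have "\<exists>y\<ge>0. y \<le> t \<and> g n y = 0"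
    using assms has_deriv by (intro IVT2) (auto intro: DERIV_isCont order_trans)
  then obtain y where "0 \<le> y" "y \<le> t" "g n y = 0" by blast
  moreover have "y \<noteq> 0" using calculation assms by auto
  ultimately show ?thesis using that[of y] by simp
qed

lemma positive_of_positive_jet:
  assumes pos: "\<And>j. g j 0 > 0" and qa: "\<not> summable (\<lambda>p. M p / M (Suc p))"
    and t: "0 \<le> t" "t \<le> a"
  shows "g 0 t > 0"
proof (rule ccontr)
  assume "\<not> g 0 t > 0"
  then obtain x where x: "0 < x" "x \<le> t" "g 0 x = 0"
    using zero_between[OF t pos] by (metis not_less)
  have "\<exists>z. \<forall>n. (0 < z n \<and> z n \<le> a \<and> g n (z n) = 0) \<and> z (Suc n) \<le> z n"
  proof (rule dependent_nat_choice)
    show "\<exists>x. 0 < x \<and> x \<le> a \<and> g 0 x = 0" using x t by (intro exI[of _ x]) auto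
    fix x n assume x: "0 < x \<and> x \<le> a \<and> g n x = 0"
    \<comment> \<open>From \<open>g n 0 > 0\<close> down to the zero at \<open>x\<close> the mean
      slope is negative, so \<open>g (Suc n)\<close> is negative somewhere before \<open>x\<close>;
      being positive at 0, it has a zero in between.\<close>
    have "\<exists>z. 0 < z \<and> z < x \<and> g n x - g n 0 = (x - 0) * g (Suc n) z"
      using x has_deriv by (intro MVT2) auto
    then obtain z where z: "0 < z" "z < x" "g n x - g n 0 = x * g (Suc n) z" by auto
    have "x * g (Suc n) z < 0" using z x pos[of n] by simp
    hence "g (Suc n) z \<le> 0" using x by (simp add: mult_less_0_iff)
    then obtain y where "0 < y" "y \<le> z" "g (Suc n) y = 0"
      using zero_between[of z "Suc n"] z x pos by auto
    thus "\<exists>y. (0 < y \<and> y \<le> a \<and> g (Suc n) y = 0) \<and> y \<le> x"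
      using z x by (intro exI[of _ y]) auto
  qed
  then obtain z where "\<And>n. 0 < z n" "\<And>n. z n \<le> a" "\<And>n. z (Suc n) \<le> z n" "\<And>n. g n (z n) = 0"
    by blast
  moreover have "g 0 0 \<noteq> 0" using pos[of 0] by simp
  ultimately show False using bang_decreasing_zeros qa by blast
qed

text \<open>Gives positivity of every derivative, and later handles jets that are positive only from
  order \<open>J\<close> on.\<close>

lemma log_convex_jet_shift: "log_convex_jet (\<lambda>j. M (j + J)) (\<lambda>j. g (j + J)) a"
  using M_pos log_convex has_deriv bound by unfold_locales auto

text \<open>All Taylor terms at 0 and the Lagrange remainder are nonnegative, so each single term is
  at most the value at \<open>a\<close>.\<close>

lemma taylor_coeff_geometric:
  assumes pos: "\<And>j. g j 0 > 0" and qa: "\<not> summable (\<lambda>p. M p / M (Suc p))"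
    and a: "0 < a"
  shows "g j 0 / fact j * a ^ j \<le> g 0 a"
proof -
  have gpos: "g i t > 0" if "0 \<le> t" "t \<le> a" for i t
  proof -
    interpret s: log_convex_jet "\<lambda>j. M (j + i)" "\<lambda>j. g (j + i)" a
      by (rule log_convex_jet_shift)
    have "\<not> summable (\<lambda>p. M (p + i) / M (Suc (p + i)))"
      using qa summable_iff_shift[of "\<lambda>p. M p / M (Suc p)" i] by simp
    thus ?thesis using s.positive_of_positive_jet[of t] pos that by simp
  qed
  have "\<exists>t. (if a < 0 then a < t \<and> t < 0 else 0 < t \<and> t < a) \<and>
      g 0 a = (\<Sum>m<Suc j. g m 0 / fact m * (a - 0) ^ m) + g (Suc j) t / fact (Suc j) * (a - 0) ^ Suc j"
    by (rule Taylor[where a = 0 and b = a]) (use a has_deriv in auto)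
  then obtain t where t: "0 < t" "t < a" and
    eq: "g 0 a = (\<Sum>m<Suc j. g m 0 / fact m * a ^ m) + g (Suc j) t / fact (Suc j) * a ^ Suc j"
    using a by auto
  have "g j 0 / fact j * a ^ j \<le> (\<Sum>m<Suc j. g m 0 / fact m * a ^ m)"
    using a pos by (intro member_le_sum) (auto simp: less_imp_le)
  moreover have "0 \<le> g (Suc j) t / fact (Suc j) * a ^ Suc j"
    using gpos[of t "Suc j"] t a by (simp add: less_imp_le)
  ultimately show ?thesis using eq by linarith
qed

end

section \<open>Restriction to a coordinate axis and geometric bounds for jets of one sign\<close>

lemma DERIV_partials_axis:
  fixes f :: "real^'n \<Rightarrow> real" and i :: "'n::finite"
  assumes "smooth_on U f" "t *\<^sub>R axis i 1 \<in> U"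
  shows "((\<lambda>t. partials is f (t *\<^sub>R axis i 1)) has_real_derivative
           partials (i # is) f (t *\<^sub>R axis i 1)) (at t)"
proof -
  let ?e = "axis i 1 :: real^'n"
  have "(\<lambda>s. partials is f (t *\<^sub>R ?e + s *\<^sub>R ?e)) differentiable (at 0)"
    using assms by (auto simp: smooth_on_def)
  hence "((\<lambda>s. partials is f (t *\<^sub>R ?e + s *\<^sub>R ?e)) has_real_derivative
           partials (i # is) f (t *\<^sub>R ?e)) (at 0)"
    by (simp add: DERIV_deriv_iff_real_differentiable[symmetric] partial_def)
  hence "((\<lambda>s. partials is f ((s + t) *\<^sub>R ?e)) has_real_derivative
           partials (i # is) f (t *\<^sub>R ?e)) (at 0)"
    by (simp add: scaleR_add_left add.commute)
  thus ?thesis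
    using DERIV_shift[of "\<lambda>t. partials is f (t *\<^sub>R ?e)" _ 0 t] by simp
qed

definition axis_index :: "'n::finite \<Rightarrow> nat \<Rightarrow> 'n \<Rightarrow> nat" where
  "axis_index i j = (\<lambda>l. if l = i then j else 0)"

lemma mlen_axis_index [simp]: "mlen (axis_index i j) = j"
  by (simp add: mlen_def axis_index_def)

text \<open>For a multi-index on an axis only one list has the prescribed counts, so the choice in
  \<open>dpartial\<close> is determined and no symmetry of mixed derivatives enters.\<close>

lemma dpartial_axis_index: "dpartial (axis_index i j) f = partials (replicate j i) f"
proof -
  have "(SOME is. \<forall>l. length (filter ((=) l) is) = axis_index i j l) = replicate j i"
  proof (rule some_equality)
    show "\<forall>l. length (filter ((=) l) (replicate j i)) = axis_index i j l"
      by (auto simp: axis_index_def)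
    fix xs assume *: "\<forall>l. length (filter ((=) l) xs) = axis_index i j l"
    have all: "x = i" if "x \<in> set xs" for x
    proof (rule ccontr)
      assume "x \<noteq> i"
      with * have "length (filter ((=) x) xs) = 0" by (simp add: axis_index_def)
      hence "filter ((=) x) xs = []" by simp
      with that show False by (auto simp: filter_empty_conv)
    qed
    hence "filter ((=) i) xs = xs" by (auto simp: filter_id_conv)
    with * have "length xs = j" by (metis axis_index_def)
    thus "xs = replicate j i" using all by (metis replicate_eqI)
  qed
  thus ?thesis by (simp add: dpartial_def)
qed

lemma quasianalytic_not_summable:
  assumes "quasianalytic M"
  shows "\<not> summable (\<lambda>p. M p / M (Suc p))"
proof
  assume "summable (\<lambda>p. M p / M (Suc p))"
  hence "(\<lambda>n. \<Sum>p<n. M p / M (Suc p)) \<longlonglongrightarrow> (\<Sum>p. M p / M (Suc p))"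
    by (rule summable_LIMSEQ)
  moreover have "(\<Sum>p=1..n. M (p - 1) / M p) = (\<Sum>p<n. M p / M (Suc p))" for n
    by (rule sum.reindex_bij_witness[of _ Suc "\<lambda>p. p - 1"]) auto
  ultimately have "(\<lambda>n. \<Sum>p=1..n. M (p - 1) / M p) \<longlonglongrightarrow> (\<Sum>p. M p / M (Suc p))"
    by simp
  moreover have "filterlim (\<lambda>n. \<Sum>p=1..n. M (p - 1) / M p) at_infinity sequentially"
    using assms filterlim_at_top_imp_at_infinity by (auto simp: quasianalytic_def)
  ultimately show False
    using not_tendsto_and_filterlim_at_infinity[OF trivial_limit_sequentially] by blast
qed

text \<open>The one-variable estimate is applied to the derivative of order \<open>J\<close> of
  \<open>\<sigma> * f\<close> along the axis, where the sign \<open>\<sigma>\<close> turns an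
  eventually negative jet into a positive one.\<close>

lemma jet_geometric:
  fixes f :: "real^'n \<Rightarrow> real" and i :: "'n::finite"
  assumes M: "weight_seq M" "quasianalytic M"
    and f: "f \<in> E_Roumieu M (cube k)" "k > 0"
    and pos: "\<And>j. J \<le> j \<Longrightarrow> \<sigma> * jet f (axis_index i j) > 0" and \<sigma>: "\<bar>\<sigma>\<bar> = 1"
  obtains C D where "0 < D" "\<And>j. J \<le> j \<Longrightarrow> \<sigma> * jet f (axis_index i j) \<le> C * D ^ j"
proof -
  \<comment> \<open>Half the half-side, so that the closed segment lies in the open cube.\<close>
  define a where "a = 1 / (2 * real k)"
  have a: "0 < a" "a < 1 / real k" using f by (auto simp: a_def field_simps)
  define L where "L = (\<lambda>t. t *\<^sub>R (axis i 1 :: real^'n)) ` {0..a}"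
  have "compact L" unfolding L_def
    by (intro compact_continuous_image continuous_intros) simp
  moreover have cube: "t *\<^sub>R (axis i 1 :: real^'n) \<in> cube k" if "0 \<le> t" "t \<le> a" for t
    using that a f(2) by (auto simp: cube_def axis_def)
  hence "L \<subseteq> cube k" by (auto simp: L_def)
  ultimately obtain h where h: "h > 0" "dc_seminorm_bounded M L h f"
    using f by (auto simp: E_Roumieu_def)
  then obtain B where B: "\<And>\<alpha> x. x \<in> L \<Longrightarrow> \<bar>dpartial \<alpha> f x\<bar> / (h ^ mlen \<alpha> * M (mlen \<alpha>)) \<le> B"
    unfolding dc_seminorm_bounded_def bdd_above_def by blast
  define C where "C = max B 1"
  have C: "C > 0" by (simp add: C_def)
  have Mpos: "M j > 0" for j using M by (simp add: weight_seq_def)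
  define g where "g = (\<lambda>j t. \<sigma> * partials (replicate j i) f (t *\<^sub>R axis i 1))"
  have jet: "\<sigma> * jet f (axis_index i j) = g j 0 / fact j" for j
    by (simp add: jet_def g_def dpartial_axis_index)
  interpret log_convex_jet "\<lambda>j. C * h ^ j * M j" g a
  proof
    fix j t
    show "0 < C * h ^ j * M j" using C h Mpos by simp
    have "(M (Suc j))\<^sup>2 \<le> M j * M (Suc (Suc j))"
      using M by (auto simp: weight_seq_def dest!: spec[of _ "Suc j"])
    hence "(C * h ^ Suc j)\<^sup>2 * (M (Suc j))\<^sup>2 \<le> (C * h ^ Suc j)\<^sup>2 * (M j * M (Suc (Suc j)))"
      by (intro mult_left_mono) auto
    thus "(C * h ^ Suc j * M (Suc j))\<^sup>2 \<le> C * h ^ j * M j * (C * h ^ Suc (Suc j) * M (Suc (Suc j)))"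
      by (simp add: power2_eq_square mult_ac)
    assume t: "0 \<le> t" "t \<le> a"
    show "(g j has_real_derivative g (Suc j) t) (at t)"
      unfolding g_def replicate_Suc
      using f by (intro DERIV_cmult DERIV_partials_axis[OF _ cube[OF t]]) (auto simp: E_Roumieu_def)
    have "t *\<^sub>R axis i 1 \<in> L" using t by (auto simp: L_def)
    from B[OF this, of "axis_index i j"]
    have "\<bar>partials (replicate j i) f (t *\<^sub>R axis i 1)\<bar> / (h ^ j * M j) \<le> C"
      by (simp add: dpartial_axis_index C_def)
    thus "\<bar>g j t\<bar> \<le> C * h ^ j * M j"
      using h Mpos[of j] \<sigma> by (simp add: g_def abs_mult pos_divide_le_eq mult_ac)
  qed
  interpret s: log_convex_jet "\<lambda>j. C * h ^ (j + J) * M (j + J)" "\<lambda>j. g (j + J)" a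
    by (rule log_convex_jet_shift)
  \<comment> \<open>Passing to the majorant \<open>C * h ^ j * M j\<close> divides the quotients by
    \<open>h\<close>, which preserves divergence.\<close>
  have "\<not> summable (\<lambda>p. (1 / h) * (M (p + J) / M (Suc (p + J))))"
    using h quasianalytic_not_summable[OF M(2)]
    by (subst summable_cmult_iff) (simp add: summable_iff_shift[of "\<lambda>p. M p / M (Suc p)"])
  also have "(\<lambda>p. (1 / h) * (M (p + J) / M (Suc (p + J))))
     = (\<lambda>p. (C * h ^ (p + J) * M (p + J)) / (C * h ^ (Suc p + J) * M (Suc p + J)))"
    using C h by (intro ext) (simp add: field_simps)
  finally have ns: "\<not> summable \<dots>" .
  have gpos: "g j 0 > 0" if "J \<le> j" for j
    using pos[OF that] unfolding jet by (simp add: zero_less_divide_iff)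
  have geo: "g (j + J) 0 / fact j * a ^ j \<le> g J a" for j
    using s.taylor_coeff_geometric[OF gpos ns a(1), of j] by simp
  show ?thesis
  proof (rule that[of "1 / a" "g J a * a ^ J"])
    show "0 < 1 / a" using a by simp
    fix j assume "J \<le> j"
    then obtain m where j: "j = m + J" by (metis le_add_diff_inverse2)
    \<comment> \<open>The shifted Taylor estimate carries \<open>fact m\<close> with
      \<open>m = j - J\<close>; the larger \<open>fact j\<close> only decreases a positive
      quotient.\<close>
    have "g j 0 / fact j \<le> g j 0 / fact m"
      using gpos[OF \<open>J \<le> j\<close>] j by (intro divide_left_mono fact_mono) auto
    also have "\<dots> \<le> g J a / a ^ m"
      using geo[of m] a by (simp add: j pos_le_divide_eq)
    also have "\<dots> = g J a * a ^ J * (1 / a) ^ j"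
      using a by (simp add: j power_add field_simps)
    finally show "\<sigma> * jet f (axis_index i j) \<le> g J a * a ^ J * (1 / a) ^ j"
      unfolding jet .
  qed
qed

section \<open>Inclusion of the Beurling jets, and the vector space of polynomial weights\<close>

lemma E_Beurling_subset_E_Roumieu: "E_Beurling M U \<subseteq> E_Roumieu M U"
  by (auto simp: E_Beurling_def E_Roumieu_def intro!: exI[of _ 1])

lemma jets_Beurling_subset_jets_Roumieu: "jets_Beurling M \<subseteq> jets_Roumieu M"
  using E_Beurling_subset_E_Roumieu by (fastforce simp: jets_Beurling_def jets_Roumieu_def)

lemma lineable_mono: "lineable A \<Longrightarrow> A \<subseteq> B \<Longrightarrow> lineable B"
  unfolding lineable_def by blast

text \<open>A polynomial factor costs at most a geometric factor, and a nonzero one has eventually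
  constant sign. Thus every nonzero element of the span is controlled, not just the members of a
  basis.\<close>

definition poly_weight :: "(nat \<Rightarrow> real) \<Rightarrow> real poly \<Rightarrow> ('n::finite \<Rightarrow> nat) \<Rightarrow> real" where
  "poly_weight s p = (\<lambda>\<alpha>. poly p (real (mlen \<alpha>)) * s (mlen \<alpha>))"

text \<open>Every natural number is the length of an axis multi-index, so \<open>p\<close> would
  have infinitely many roots.\<close>

lemma poly_weight_eq_0_imp:
  fixes s :: "nat \<Rightarrow> real"
  assumes "\<And>k. s k > 0" "(poly_weight s p :: ('n::finite \<Rightarrow> nat) \<Rightarrow> real) = (\<lambda>_. 0)"
  shows "p = 0"
proof (rule ccontr)
  assume "p \<noteq> 0"
  hence "finite {x. poly p x = 0}" by (rule poly_roots_finite)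
  moreover have "poly p (real k) = 0" for k
    using fun_cong[OF assms(2), of "axis_index undefined k"] assms(1)[of k]
    by (simp add: poly_weight_def)
  hence "range real \<subseteq> {x. poly p x = 0}" by auto
  ultimately have "finite (range real)" by (rule finite_subset[rotated])
  thus False by (simp add: finite_image_iff inj_on_def)
qed

lemma sum_poly_weight_monom:
  "(\<Sum>j\<in>T. c j * poly_weight s (monom 1 j) \<alpha>) = poly_weight s (\<Sum>j\<in>T. monom (c j) j) \<alpha>"
  by (simp add: poly_weight_def poly_sum poly_monom sum_distrib_right sum_distrib_left mult_ac)

text \<open>\<open>poly_weight s\<close> is linear and, by \<open>poly_weight_eq_0_imp\<close>,
  injective; hence the images of the monomials form an infinite independent family.\<close>

lemma lineable_poly_weight:
  fixes s :: "nat \<Rightarrow> real" and A :: "(('n::finite \<Rightarrow> nat) \<Rightarrow> real) set"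
  assumes s: "\<And>k. s k > 0" and A: "\<And>p. p \<noteq> 0 \<Longrightarrow> poly_weight s p \<in> A"
  shows "lineable A"
  unfolding lineable_def
proof (intro exI[of _ "range (poly_weight s)"] conjI)
  let ?w = "\<lambda>j. poly_weight s (monom 1 j) :: ('n \<Rightarrow> nat) \<Rightarrow> real"
  have zero: "poly_weight s 0 = (\<lambda>_ :: 'n \<Rightarrow> nat. 0)" by (simp add: poly_weight_def)
  show "is_subspace (range (poly_weight s) :: (('n \<Rightarrow> nat) \<Rightarrow> real) set)"
    unfolding is_subspace_def
  proof (intro conjI ballI allI)
    show "(\<lambda>_ :: 'n \<Rightarrow> nat. 0) \<in> range (poly_weight s)"
      using zero by (intro range_eqI[where x = 0]) simp
  next
    fix u v :: "('n \<Rightarrow> nat) \<Rightarrow> real"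
    assume "u \<in> range (poly_weight s)" "v \<in> range (poly_weight s)"
    then obtain p q where "u = poly_weight s p" "v = poly_weight s q" by blast
    hence "(\<lambda>a. u a + v a) = poly_weight s (p + q)"
      by (simp add: poly_weight_def distrib_right)
    thus "(\<lambda>a. u a + v a) \<in> range (poly_weight s)" by simp
  next
    fix c and u :: "('n \<Rightarrow> nat) \<Rightarrow> real"
    assume "u \<in> range (poly_weight s)"
    then obtain p where "u = poly_weight s p" by blast
    hence "(\<lambda>a. c * u a) = poly_weight s (smult c p)"
      by (simp add: poly_weight_def mult.assoc)
    thus "(\<lambda>a. c * u a) \<in> range (poly_weight s)" by simp
  qed
  show "range (poly_weight s) \<subseteq> A \<union> {\<lambda>_. 0}"
  proof
    fix u :: "('n \<Rightarrow> nat) \<Rightarrow> real" assume "u \<in> range (poly_weight s)"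
    then obtain p where "u = poly_weight s p" by blast
    thus "u \<in> A \<union> {\<lambda>_. 0}" using A[of p] zero by (cases "p = 0") auto
  qed
  have inj: "inj ?w"
  proof (rule injI)
    fix i j assume eq: "?w i = ?w j"
    have "poly_weight s (monom 1 i - monom 1 j) = (\<lambda>\<alpha>. ?w i \<alpha> - ?w j \<alpha>)"
      by (simp add: poly_weight_def left_diff_distrib)
    hence "poly_weight s (monom 1 i - monom 1 j) = (\<lambda>_ :: 'n \<Rightarrow> nat. 0)" using eq by simp
    hence "(monom 1 i :: real poly) - monom 1 j = 0" by (rule poly_weight_eq_0_imp[OF s])
    hence "monom 1 i = (monom 1 j :: real poly)" by simp
    hence "coeff (monom 1 i) i = coeff (monom 1 j :: real poly) i" by simp
    thus "i = j" by (simp split: if_splits)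
  qed
  show "infinite_dim (range (poly_weight s) :: (('n \<Rightarrow> nat) \<Rightarrow> real) set)"
    unfolding infinite_dim_def
  proof (intro exI[of _ "range ?w"] conjI)
    show "range ?w \<subseteq> range (poly_weight s)" by auto
    show "infinite (range ?w)" using inj by (simp add: finite_image_iff)
    show "lin_indep (range ?w)"
      unfolding lin_indep_def
    proof (intro allI impI ballI, elim conjE)
      fix F :: "(('n \<Rightarrow> nat) \<Rightarrow> real) set" and c u
      assume F: "finite F" "F \<subseteq> range ?w" and u: "u \<in> F"
        and eq: "(\<lambda>a. \<Sum>u\<in>F. c u * u a) = (\<lambda>_. 0)"
      obtain T where T: "finite T" "F = ?w ` T"
        using finite_subset_image[OF F] by blast
      have injT: "inj_on ?w T" using inj by (rule inj_on_subset) simp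
      \<comment> \<open>The polynomial that encodes the linear relation; its coefficients are those
        of the relation.\<close>
      let ?p = "\<Sum>j\<in>T. monom (c (?w j)) j"
      have "poly_weight s ?p = (\<lambda>_ :: 'n \<Rightarrow> nat. 0)"
      proof
        fix \<alpha> :: "'n \<Rightarrow> nat"
        have "poly_weight s ?p \<alpha> = (\<Sum>j\<in>T. c (?w j) * ?w j \<alpha>)"
          by (rule sum_poly_weight_monom[symmetric])
        also have "\<dots> = (\<Sum>u\<in>F. c u * u \<alpha>)"
          unfolding T(2) by (subst sum.reindex[OF injT]) simp
        also have "\<dots> = 0" using fun_cong[OF eq] .
        finally show "poly_weight s ?p \<alpha> = 0" .
      qed
      hence p: "?p = 0" by (rule poly_weight_eq_0_imp[OF s])
      obtain i where i: "i \<in> T" "u = ?w i" using u T by blast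
      have "coeff ?p i = c u"
        using i T(1) by (simp add: coeff_sum)
      thus "c u = 0" using p by simp
    qed
  qed
qed

section \<open>Growth of polynomial weights: membership in the sequence spaces and exclusion from
  the jets\<close>

lemma poly_eventually_bounded_below:
  fixes p :: "real poly"
  assumes "p \<noteq> 0"
  obtains \<sigma> c J where "\<bar>\<sigma>\<bar> = 1" "c > 0" "\<And>k. J \<le> k \<Longrightarrow> c \<le> \<sigma> * poly p (real k)"
proof -
  define \<sigma> :: real where "\<sigma> = sgn (lead_coeff p)"
  have \<sigma>: "\<bar>\<sigma>\<bar> = 1" using assms by (simp add: \<sigma>_def sgn_if)
  define q where "q = smult \<sigma> p"
  have q: "lead_coeff q > 0"
    using assms leading_coeff_0_iff[of p] by (auto simp: q_def \<sigma>_def sgn_if not_less order.order_iff_strict)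
  then obtain n where n: "\<And>x. n \<le> x \<Longrightarrow> lead_coeff q \<le> poly q x"
    using poly_pinfty_gt_lc by blast
  show ?thesis
  \<comment> \<open>The lower bound \<open>c\<close> is the leading coefficient of \<open>q\<close>,
    which \<open>poly q\<close> eventually reaches or exceeds.\<close>
  proof (rule that[OF \<sigma> q, of "nat \<lceil>n\<rceil>"])
    fix k assume "nat \<lceil>n\<rceil> \<le> k"
    hence "n \<le> real k" by linarith
    thus "lead_coeff q \<le> \<sigma> * poly p (real k)" using n by (simp add: q_def)
  qed
qed

lemma poly_exponentially_bounded:
  fixes p :: "real poly"
  shows "\<exists>C R. 0 < C \<and> 0 < R \<and> (\<forall>k. \<bar>poly p (real k)\<bar> \<le> C * R ^ k)"
proof (induction p)
  case 0
  show ?case by (intro exI[of _ 1]) simp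
next
  case (pCons b p)
  then obtain C R where CR: "0 < C" "0 < R" "\<And>k. \<bar>poly p (real k)\<bar> \<le> C * R ^ k" by blast
  \<comment> \<open>The 2 pays for the factor \<open>real k \<le> 2 ^ k\<close> of a Horner step,
    the maximum ensures \<open>1 \<le> Q ^ k\<close> for the constant term.\<close>
  define Q where "Q = 2 * max R 1"
  have "\<bar>poly (pCons b p) (real k)\<bar> \<le> (\<bar>b\<bar> + C) * Q ^ k" for k
  proof -
    have "\<bar>poly (pCons b p) (real k)\<bar> \<le> \<bar>b\<bar> + real k * \<bar>poly p (real k)\<bar>"
      by (simp add: order_trans[OF abs_triangle_ineq] abs_mult)
    also have "\<dots> \<le> \<bar>b\<bar> * Q ^ k + 2 ^ k * (C * max R 1 ^ k)"
    proof (rule add_mono)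
      have "1 \<le> Q ^ k" by (rule one_le_power) (simp add: Q_def)
      hence "\<bar>b\<bar> * 1 \<le> \<bar>b\<bar> * Q ^ k" by (intro mult_left_mono) auto
      thus "\<bar>b\<bar> \<le> \<bar>b\<bar> * Q ^ k" by simp
      have "C * R ^ k \<le> C * max R 1 ^ k"
        using CR by (intro mult_left_mono power_mono) auto
      hence "\<bar>poly p (real k)\<bar> \<le> C * max R 1 ^ k" using CR(3)[of k] by linarith
      thus "real k * \<bar>poly p (real k)\<bar> \<le> 2 ^ k * (C * max R 1 ^ k)"
        using of_nat_less_two_power[of k] by (intro mult_mono) (auto simp: less_imp_le)
    qed
    also have "\<dots> = (\<bar>b\<bar> + C) * Q ^ k" by (simp add: Q_def algebra_simps)
    finally show ?thesis .
  qed
  moreover have "0 < \<bar>b\<bar> + C" "0 < Q" using CR by (auto simp: Q_def)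
  ultimately show ?case by blast
qed

text \<open>Under a geometric bound the roots are eventually at most \<open>max C 1 * D\<close>, and
  the finitely many others are bounded anyway.\<close>

lemma unbounded_roots_not_geometric:
  fixes n :: "nat \<Rightarrow> real"
  assumes "\<forall>C. \<exists>k>0. root k (n k) > C" and pos: "\<And>k. n k > 0"
    and D: "0 < D" and le: "\<And>k. J \<le> k \<Longrightarrow> n k \<le> C * D ^ k"
  shows False
proof -
  have "\<forall>\<^sub>F k in sequentially. norm (root k (n k)) \<le> norm (max C 1 * D)"
    using eventually_ge_at_top[of "max J 1"]
  proof eventually_elim
    case (elim k)
    have "n k \<le> C * D ^ k" using le elim by simp
    also have "\<dots> \<le> max C 1 ^ k * D ^ k"
    proof (rule mult_right_mono)
      have "max C 1 \<le> max C 1 ^ k" using elim by (intro self_le_power) auto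
      thus "C \<le> max C 1 ^ k" by linarith
    qed (use D in simp)
    also have "\<dots> = (max C 1 * D) ^ k" by (simp add: power_mult_distrib)
    finally have "root k (n k) \<le> root k ((max C 1 * D) ^ k)"
      using elim by (intro real_root_le_mono) auto
    also have "\<dots> = max C 1 * D" using elim D by (intro real_root_power_cancel) auto
    finally show ?case using pos[of k] elim by (simp add: less_imp_le)
  qed
  hence "Bseq (\<lambda>k. root k (n k))"
    by (rule Bseq_eventually_mono) simp
  then obtain B where B: "\<And>k. norm (root k (n k)) \<le> B" by (auto simp: Bseq_def)
  obtain k where "root k (n k) > B" using assms(1) by blast
  with B[of k] show False by simp
qed

text \<open>On a single axis the signed jet dominates \<open>c * s j\<close> from some order on, so
  \<open>jet_geometric\<close> would bound \<open>s\<close> geometrically.\<close>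

lemma poly_weight_not_jet:
  fixes s :: "nat \<Rightarrow> real"
  assumes M: "weight_seq M" "quasianalytic M" and s: "\<And>k. s k > 0" and p: "p \<noteq> 0"
    and not_geo: "\<And>C D J. \<lbrakk>0 < D; \<And>k. J \<le> k \<Longrightarrow> s k \<le> C * D ^ k\<rbrakk> \<Longrightarrow> False"
  shows "(poly_weight s p :: ('n::finite \<Rightarrow> nat) \<Rightarrow> real) \<notin> jets_Roumieu M"
proof
  assume "(poly_weight s p :: ('n \<Rightarrow> nat) \<Rightarrow> real) \<in> jets_Roumieu M"
  then obtain f :: "real^'n \<Rightarrow> real" and k where
    f: "f \<in> E_Roumieu M (cube k)" "k > 0" and jet: "poly_weight s p = jet f"
    by (auto simp: jets_Roumieu_def)
  obtain \<sigma> c J where \<sigma>: "\<bar>\<sigma>\<bar> = 1" and c: "c > 0" and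
    low: "\<And>k. J \<le> k \<Longrightarrow> c \<le> \<sigma> * poly p (real k)"
    using poly_eventually_bounded_below[OF p] by blast
  \<comment> \<open>Any coordinate serves.\<close>
  let ?i = "undefined :: 'n"
  have low': "c * s j \<le> \<sigma> * jet f (axis_index ?i j)" if "J \<le> j" for j
    using mult_right_mono[OF low[OF that], of "s j"] s[of j]
    by (simp add: jet[symmetric] poly_weight_def mult.assoc)
  have "\<sigma> * jet f (axis_index ?i j) > 0" if "J \<le> j" for j
    using low'[OF that] c s[of j] by (meson less_le_trans mult_pos_pos)
  from jet_geometric[OF M f this \<sigma>] obtain C D where
    D: "0 < D" "\<And>j. J \<le> j \<Longrightarrow> \<sigma> * jet f (axis_index ?i j) \<le> C * D ^ j" by blast
  have "s j \<le> C / c * D ^ j" if "J \<le> j" for j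
  proof -
    have "c * s j \<le> C * D ^ j" using low' D(2) that by (meson order_trans)
    thus ?thesis using c by (simp add: field_simps)
  qed
  with D(1) show False by (rule not_geo)
qed

lemma seq_bounded_poly_weight:
  fixes s :: "nat \<Rightarrow> real"
  assumes "\<And>k. N k > 0" "h > 0" "\<And>k. s k \<ge> 0"
    and "\<And>k. \<bar>poly p (real k)\<bar> * s k \<le> C * (h ^ k * (N k / fact k))"
  shows "seq_bounded N h (poly_weight s p :: ('n::finite \<Rightarrow> nat) \<Rightarrow> real)"
  unfolding seq_bounded_def
proof (rule bdd_aboveI[of _ C], safe)
  fix \<alpha> :: "'n \<Rightarrow> nat"
  have "0 < h ^ mlen \<alpha> * (N (mlen \<alpha>) / fact (mlen \<alpha>))" using assms by simp
  thus "\<bar>poly_weight s p \<alpha>\<bar> / (h ^ mlen \<alpha> * (N (mlen \<alpha>) / fact (mlen \<alpha>))) \<le> C"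
    using assms(4)[of "mlen \<alpha>"] assms(3)[of "mlen \<alpha>"]
    by (simp only: pos_divide_le_eq poly_weight_def abs_mult abs_of_nonneg)
qed

lemma poly_weight_in_Lambda_Roumieu:
  assumes "\<And>k. N k > 0"
  shows "(poly_weight (\<lambda>k. N k / fact k) p :: ('n::finite \<Rightarrow> nat) \<Rightarrow> real) \<in> Lambda_Roumieu N"
proof -
  obtain C R where CR: "0 < C" "0 < R" "\<And>k. \<bar>poly p (real k)\<bar> \<le> C * R ^ k"
    using poly_exponentially_bounded by blast
  have "\<bar>poly p (real k)\<bar> * (N k / fact k) \<le> C * (R ^ k * (N k / fact k))" for k
    using mult_right_mono[OF CR(3)[of k], of "N k / fact k"] assms[of k] by (simp add: mult.assoc)
  hence "seq_bounded N R (poly_weight (\<lambda>k. N k / fact k) p :: ('n \<Rightarrow> nat) \<Rightarrow> real)"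
    using assms CR by (intro seq_bounded_poly_weight) (auto simp: less_imp_le)
  thus ?thesis using CR by (auto simp: Lambda_Roumieu_def)
qed

text \<open>Dividing by \<open>h ^ k\<close> times \<open>N k / fact k\<close> leaves at most
  \<open>C * (R / h) ^ k / sqrt (N k / fact k)\<close>. This is bounded for every \<open>h\<close>,
  as the roots of \<open>N k / fact k\<close> eventually exceed
  \<open>(R / h)\<^sup>2\<close>.\<close>

lemma poly_weight_in_Lambda_Beurling:
  assumes N: "\<And>k. N k > 0"
    and lim: "filterlim (\<lambda>k. root k (N k / fact k)) at_top sequentially"
  shows "(poly_weight (\<lambda>k. sqrt (N k / fact k)) p :: ('n::finite \<Rightarrow> nat) \<Rightarrow> real) \<in> Lambda_Beurling N"
proof -
  define n where "n = (\<lambda>k. N k / fact k)"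
  have n: "n k > 0" for k using N by (simp add: n_def)
  obtain C R where CR: "0 < C" "0 < R" "\<And>k. \<bar>poly p (real k)\<bar> \<le> C * R ^ k"
    using poly_exponentially_bounded by blast
  have "seq_bounded N h (poly_weight (\<lambda>k. sqrt (n k)) p :: ('n \<Rightarrow> nat) \<Rightarrow> real)" if h: "h > 0" for h
  proof -
    have "\<forall>\<^sub>F k in sequentially. root k (n k) \<ge> (R / h)\<^sup>2"
      using lim by (simp add: filterlim_at_top n_def)
    hence "\<forall>\<^sub>F k in sequentially. norm ((R / h) ^ k / sqrt (n k)) \<le> norm (1 :: real)"
      using eventually_gt_at_top[of 0]
    proof eventually_elim
      case (elim k)
      have "((R / h) ^ k)\<^sup>2 = ((R / h)\<^sup>2) ^ k" by (simp add: power_mult[symmetric] mult.commute)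
      also have "\<dots> \<le> root k (n k) ^ k" using elim by (intro power_mono) auto
      also have "\<dots> = n k" using elim n[of k] by simp
      finally have "(R / h) ^ k \<le> sqrt (n k)" by (rule real_le_rsqrt)
      thus ?case using CR h n[of k] by simp
    qed
    hence "Bseq (\<lambda>k. (R / h) ^ k / sqrt (n k))" by (rule Bseq_eventually_mono) simp
    then obtain B where B: "\<And>k. norm ((R / h) ^ k / sqrt (n k)) \<le> B" by (auto simp: Bseq_def)
    have "\<bar>poly p (real k)\<bar> * sqrt (n k) \<le> C * B * (h ^ k * (N k / fact k))" for k
    proof -
      have "(R / h) ^ k / sqrt (n k) \<le> B"
        using B[of k] abs_ge_self order_trans unfolding real_norm_def by blast
      hence *: "R ^ k \<le> B * sqrt (n k) * h ^ k"
        using n[of k] h by (simp add: field_simps)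
      have "\<bar>poly p (real k)\<bar> * sqrt (n k) \<le> C * R ^ k * sqrt (n k)"
        using CR n[of k] by (intro mult_right_mono) auto
      also have "\<dots> \<le> C * (B * sqrt (n k) * h ^ k) * sqrt (n k)"
        using CR n[of k] * by (intro mult_right_mono mult_left_mono) auto
      also have "\<dots> = C * B * (h ^ k * (sqrt (n k))\<^sup>2)" by (simp add: power2_eq_square mult_ac)
      also have "(sqrt (n k))\<^sup>2 = N k / fact k" using n[of k] by (simp add: n_def)
      finally show ?thesis .
    qed
    thus ?thesis using N h n by (intro seq_bounded_poly_weight) (auto simp: less_imp_le)
  qed
  thus ?thesis by (simp add: Lambda_Beurling_def n_def)
qed

section \<open>Lineability in the Roumieu and Beurling cases\<close>

theorem mainTheorem7:
  fixes M N :: "nat \<Rightarrow> real"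
  assumes "weight_seq M" "quasianalytic M"
      and "weight_seq N" "quasianalytic N"
  shows "((\<forall>C. \<exists>k>0. root k (N k / fact k) > C) \<longrightarrow>
            lineable ((Lambda_Roumieu N :: (('n::finite \<Rightarrow> nat) \<Rightarrow> real) set) - jets_Roumieu M) \<and>
            lineable ((Lambda_Roumieu N :: (('n::finite \<Rightarrow> nat) \<Rightarrow> real) set) - jets_Beurling M))
       \<and> (filterlim (\<lambda>k. root k (N k / fact k)) at_top sequentially \<longrightarrow>
            lineable ((Lambda_Beurling N :: (('n::finite \<Rightarrow> nat) \<Rightarrow> real) set) - jets_Roumieu M) \<and>
            lineable ((Lambda_Beurling N :: (('n::finite \<Rightarrow> nat) \<Rightarrow> real) set) - jets_Beurling M))"
proof -
  have N: "N k > 0" for k using assms by (simp add: weight_seq_def)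
  hence n: "N k / fact k > 0" for k by simp
  \<comment> \<open>Removing the smaller set of Beurling jets leaves a larger set, so the Roumieu
    jets decide both claims.\<close>
  have red: "lineable (A - jets_Roumieu M) \<and> lineable (A - jets_Beurling M)"
    if "lineable (A - jets_Roumieu M)" for A :: "(('n \<Rightarrow> nat) \<Rightarrow> real) set"
    using that jets_Beurling_subset_jets_Roumieu by (blast intro: lineable_mono)
  show ?thesis
  proof (intro conjI[of "_ \<longrightarrow> _"] impI red)
    assume unb: "\<forall>C. \<exists>k>0. root k (N k / fact k) > C"
    show "lineable ((Lambda_Roumieu N :: (('n \<Rightarrow> nat) \<Rightarrow> real) set) - jets_Roumieu M)"
    proof (rule lineable_poly_weight[OF n])
      fix p :: "real poly" assume p: "p \<noteq> 0"
      have "(poly_weight (\<lambda>k. N k / fact k) p :: ('n \<Rightarrow> nat) \<Rightarrow> real) \<notin> jets_Roumieu M"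
        by (rule poly_weight_not_jet[OF assms(1,2) n p]) (rule unbounded_roots_not_geometric[OF unb n])
      thus "(poly_weight (\<lambda>k. N k / fact k) p :: ('n \<Rightarrow> nat) \<Rightarrow> real) \<in> Lambda_Roumieu N - jets_Roumieu M"
        using poly_weight_in_Lambda_Roumieu[of N p] N by blast
    qed
  next
    assume lim: "filterlim (\<lambda>k. root k (N k / fact k)) at_top sequentially"
    have unb: "\<forall>C. \<exists>k>0. root k (N k / fact k) > C"
    proof
      fix C
      have "\<forall>\<^sub>F k in sequentially. root k (N k / fact k) > C \<and> k > 0"
        using lim eventually_gt_at_top[of 0] by (intro eventually_conj) (auto simp: filterlim_at_top_dense)
      thus "\<exists>k>0. root k (N k / fact k) > C"
        using eventually_happens'[OF sequentially_bot] by blast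
    qed
    have s: "sqrt (N k / fact k) > 0" for k using n[of k] by simp
    show "lineable ((Lambda_Beurling N :: (('n \<Rightarrow> nat) \<Rightarrow> real) set) - jets_Roumieu M)"
    proof (rule lineable_poly_weight[OF s])
      fix p :: "real poly" assume p: "p \<noteq> 0"
      have "(poly_weight (\<lambda>k. sqrt (N k / fact k)) p :: ('n \<Rightarrow> nat) \<Rightarrow> real) \<notin> jets_Roumieu M"
      proof (rule poly_weight_not_jet[OF assms(1,2) s p])
        fix C D :: real and J
        assume D: "0 < D" and le: "\<And>k. J \<le> k \<Longrightarrow> sqrt (N k / fact k) \<le> C * D ^ k"
        \<comment> \<open>Squaring carries a geometric bound on the square roots over to
          \<open>N k / fact k\<close>, whose roots are unbounded.\<close>
        have "N k / fact k \<le> C\<^sup>2 * (D\<^sup>2) ^ k" if "J \<le> k" for k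
        proof -
          have "(sqrt (N k / fact k))\<^sup>2 \<le> (C * D ^ k)\<^sup>2"
            using le[OF that] n[of k] by (intro power_mono) auto
          thus ?thesis using n[of k]
            by (simp add: power_mult_distrib power_mult[symmetric] mult.commute)
        qed
        moreover have "0 < D\<^sup>2" using D by simp
        ultimately show False using unbounded_roots_not_geometric[OF unb n] by blast
      qed
      thus "(poly_weight (\<lambda>k. sqrt (N k / fact k)) p :: ('n \<Rightarrow> nat) \<Rightarrow> real)
          \<in> Lambda_Beurling N - jets_Roumieu M"
        using poly_weight_in_Lambda_Beurling[of N p] N lim by blast
    qed
  qed
qed

end
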